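(* Let $S$ be a semigroup of bounded exponent. Then $\Gamma(S)$ is a tree if and only if $|E(S)|=1$ and $\pi(S)\subseteq\{1,2\}$.
   Context: For a subset $X$ of a semigroup $S$, $\langle X\rangle$ denotes the subsemigroup generated by $X$; a semigroup is monogenic if it equals $\langle a\rangle=\{a^k : k\in\mathbb{N}\}$ for some element $a$, where $\mathbb{N}=\{1,2,\dots\}$. The cyclic graph $\Gamma(S)$ is the simple undirected graph with vertex set $S$ in which two distinct vertices $x,y$ are adjacent if and only if $\langle x,y\rangle$ is a monogenic subsemigroup of $S$. $E(S)$ is the set of idempotents of $S$. $S$ is of bounded exponent if there is a positive integer $n$ such that for every $x\in S$, $x^n$ is an idempotent. The order of $a\in S$ is $o(a)=|\langle a\rangle|$, and $\pi(S)=\{o(a): a\in S\}$. *)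

theory Defs
  imports "Graph_Theory.Digraph_Component"
begin

section \<open>Semigroups\<close>

text \<open>
  A semigroup is represented by its carrier: a multiplicatively closed set in a type of class
  \<^class>\<open>semigroup_mult\<close>. The whole type, \<^term>\<open>UNIV\<close>, is the special case of an arbitrary
  nonempty semigroup.
\<close>

definition subsemigroup :: "'a::semigroup_mult set \<Rightarrow> bool" where
  "subsemigroup S \<longleftrightarrow> (\<forall>x\<in>S. \<forall>y\<in>S. x * y \<in> S)"

definition generated :: "'a::semigroup_mult set \<Rightarrow> 'a set" where
  "generated X = subsemigroup hull X"

text \<open>
  There is no unit, so \<open>a\<^sup>n\<close> is meaningful only for \<open>n \<ge> 1\<close>; \<open>sg_power a 0\<close> is a junk value.
\<close>

definition sg_power :: "'a::semigroup_mult \<Rightarrow> nat \<Rightarrow> 'a" where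
  "sg_power a n = ((\<lambda>y. y * a) ^^ (n - 1)) a"

lemma sg_power_1: "sg_power a 1 = a"
  by (simp add: sg_power_def)

lemma sg_power_Suc: "n \<ge> 1 \<Longrightarrow> sg_power a (Suc n) = sg_power a n * a"
  by (cases n) (simp_all add: sg_power_def)

lemma sg_power_add:
  assumes "m \<ge> 1" "n \<ge> 1"
  shows "sg_power a m * sg_power a n = sg_power a (m + n)"
  using assms(2,1)
  by (induction n rule: nat_induct_at_least)
     (simp_all add: sg_power_1[simplified] sg_power_Suc mult.assoc [symmetric])

lemma generated_singleton: "generated {a} = {sg_power a k | k. k \<ge> 1}"
proof
  have "subsemigroup {sg_power a k | k. k \<ge> 1}"
    unfolding subsemigroup_def
  proof (intro ballI)
    fix x y
    assume "x \<in> {sg_power a k | k. k \<ge> 1}" "y \<in> {sg_power a k | k. k \<ge> 1}"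
    then obtain m n where "m \<ge> 1" "n \<ge> 1" "x = sg_power a m" "y = sg_power a n"
      by blast
    then show "x * y \<in> {sg_power a k | k. k \<ge> 1}"
      using sg_power_add[of m n a] by (auto intro!: exI[of _ "m + n"])
  qed
  moreover have "{a} \<subseteq> {sg_power a k | k. k \<ge> 1}"
    using sg_power_1[of a] by force
  ultimately show "generated {a} \<subseteq> {sg_power a k | k. k \<ge> 1}"
    unfolding generated_def by (rule hull_minimal[rotated])
next
  have sub: "subsemigroup (generated {a})"
    unfolding generated_def hull_def subsemigroup_def by blast
  have a: "a \<in> generated {a}"
    unfolding generated_def by (rule hull_inc) simp
  have "sg_power a k \<in> generated {a}" if "k \<ge> 1" for k
    using that
  proof (induction k rule: nat_induct_at_least)
    case base
    show ?case using a by (simp only: sg_power_1)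
  next
    case (Suc n)
    then show ?case using a sub by (simp add: sg_power_Suc subsemigroup_def)
  qed
  then show "{sg_power a k | k. k \<ge> 1} \<subseteq> generated {a}"
    by blast
qed

definition monogenic :: "'a::semigroup_mult set \<Rightarrow> bool" where
  "monogenic T \<longleftrightarrow> (\<exists>a. T = generated {a})"

definition idempotents :: "'a::semigroup_mult set \<Rightarrow> 'a set" where
  "idempotents S = {e \<in> S. e * e = e}"

definition bounded_exponent :: "'a::semigroup_mult set \<Rightarrow> bool" where
  "bounded_exponent S \<longleftrightarrow> (\<exists>n\<ge>1. \<forall>x\<in>S. sg_power x n \<in> idempotents S)"

text \<open>
  By the convention of \<^const>\<open>card\<close>, an element of infinite order gets \<open>elem_order\<close> 0.
\<close>

definition elem_order :: "'a::semigroup_mult \<Rightarrow> nat" where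
  "elem_order a = card (generated {a})"

definition order_set :: "'a::semigroup_mult set \<Rightarrow> nat set" where
  "order_set S = elem_order ` S"

section \<open>The cyclic graph\<close>

text \<open>
  An undirected simple graph is represented as a loop-free symmetric digraph on pairs, each edge
  giving two opposite arcs.
\<close>

definition cyclic_graph :: "'a::semigroup_mult set \<Rightarrow> 'a pair_pre_digraph" where
  "cyclic_graph S =
     \<lparr> pverts = S, parcs = {(x, y) \<in> S \<times> S. x \<noteq> y \<and> monogenic (generated {x, y})} \<rparr>"

lemma cyclic_graph_bidirected: "pair_bidirected_digraph (cyclic_graph S)"
  by unfold_locales (auto simp: cyclic_graph_def symmetric_def sym_def insert_commute)

text \<open>
  The library's \<^const>\<open>tree\<close> is about digraphs: there the two opposite arcs of a single edge
  already form a cycle \<open>a, b, a\<close>. Cycles of an undirected simple graph are the cycles of length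
  at least 3 of its symmetric digraph. The library's \<^const>\<open>connected\<close> also demands that the
  graph has a vertex.
\<close>

definition undirected_tree :: "'a pair_pre_digraph \<Rightarrow> bool" where
  "undirected_tree G \<longleftrightarrow>
     connected (with_proj G) \<and>
     \<not> (\<exists>p. pre_digraph.cycle (with_proj G) p \<and> length p \<ge> 3)"

end

theory Submission
  imports Defs
begin

text \<open>
  A generator \<open>a\<close> is adjacent to each of its other powers, and in every monogenic semigroup with
  at least three elements two further powers are adjacent to each other, so an element whose
  order is not 1 or 2 yields a triangle (\<open>cyclic_graph_triangle\<close>). In an acyclic cyclic graph
  every square is therefore idempotent. Two idempotents in one monogenic semigroup coincide, so
  \<open>x \<mapsto> x\<^sup>2\<close> is constant along edges; if the graph is connected, it is constant, and since it
  fixes every idempotent there is exactly one.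

  Conversely, let \<open>e\<close> be the only idempotent and let all orders be 1 or 2. Then every
  element squares to \<open>e\<close>, so that it generates at most itself and \<open>e\<close>. Hence \<open>e\<close> is adjacent
  to all other elements, and a monogenic subsemigroup cannot contain two distinct elements
  besides \<open>e\<close>: the graph is a star with centre \<open>e\<close>.
\<close>

section \<open>Stars, triangles and connectedness\<close>

lemma adjacent_imp_eq_imp_connected_imp_eq:
  assumes conn: "connected G"
    and adj: "\<And>a. a \<in> arcs G \<Longrightarrow> f (tail G a) = f (head G a)"
    and u: "u \<in> verts G" and v: "v \<in> verts G"
  shows "f u = f v"
proof -
  have "u \<rightarrow>\<^sup>*\<^bsub>with_proj (mk_symmetric G)\<^esub> v"
    using conn u v by (auto simp: connected_def strongly_connected_def mk_symmetric_def)
  then have "(u, v) \<in> (parcs (mk_symmetric G))\<^sup>*"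
    unfolding reachable_def with_proj_simps by (rule rtrancl_on_rtranclI)
  then show ?thesis
  proof induction
    case base
    show ?case by simp
  next
    case (step y z)
    then obtain a where "a \<in> arcs G" "{y, z} = {tail G a, head G a}"
      by (auto simp: mk_symmetric_def)
    then have "f y = f z"
      using adj by (metis doubleton_eq_iff)
    with step.IH show ?case by simp
  qed
qed

lemma triangle_cycle:
  assumes "a \<in> pverts G" "(a, b) \<in> parcs G" "(b, c) \<in> parcs G" "(c, a) \<in> parcs G"
    and "distinct [a, b, c]"
  shows "pre_digraph.cycle (with_proj G) [(a, b), (b, c), (c, a)]"
  using assms
  by (auto simp: pre_digraph.cycle_def pre_digraph.awalk_def cas_with_proj_eq
      awalk_verts_with_proj_eq intro!: exI[of _ a])

text \<open>
  Among three consecutive arcs \<open>(u, v)\<close>, \<open>(v, w)\<close>, \<open>(w, x)\<close> of a cycle, the middle one has the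
  centre as an endpoint; the opposite neighbouring arc then misses the centre, because on a
  cycle of length at least 3 the centre occurs only once.
\<close>

lemma star_no_cycle:
  assumes star: "\<And>x y. (x, y) \<in> parcs G \<Longrightarrow> x = e \<or> y = e"
    and cyc: "pre_digraph.cycle (with_proj G) p"
  shows "length p < 3"
proof (rule ccontr)
  assume "\<not> length p < 3"
  then obtain a b c q where p: "p = a # b # c # q"
    by (auto simp: not_less numeral_3_eq_3 Suc_le_length_iff)
  obtain u where arcs: "set p \<subseteq> parcs G" and cas: "pcas u p u"
    and dist: "distinct (tl (pawalk_verts u p))"
    using cyc by (auto simp: pre_digraph.cycle_def pre_digraph.awalk_def cas_with_proj_eq
        awalk_verts_with_proj_eq)
  have end_in: "z \<in> set (pawalk_verts w r)" if "pcas w r z" for w r z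
    using that by (induction r arbitrary: w) auto
  have start_in: "w \<in> set (pawalk_verts w r)" if "pcas w r z" for w r z
    using that by (cases r) auto
  obtain v w x where abc: "a = (u, v)" "b = (v, w)" "c = (w, x)" and q: "pcas x q u"
    using cas by (cases a; cases b; cases c) (auto simp: p)
  have "v \<noteq> w" "w \<noteq> x" "v \<noteq> x" "w \<noteq> u"
    using dist end_in[OF q] start_in[OF q] by (auto simp: p abc)
  then show False
    using star[of u v] star[of v w] star[of w x] arcs by (auto simp: p abc)
qed

lemma star_connected:
  assumes wf: "wf_digraph (with_proj G)" and e: "e \<in> pverts G"
    and star: "\<And>x. x \<in> pverts G \<Longrightarrow> x \<noteq> e \<Longrightarrow> (x, e) \<in> parcs G"
  shows "connected (with_proj G)"
proof -
  let ?H = "with_proj (mk_symmetric (with_proj G))"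
  interpret wf_digraph "with_proj G" by (rule wf)
  interpret H: wf_digraph ?H
    using wellformed by unfold_locales (auto simp: mk_symmetric_def)
  have "x \<rightarrow>\<^sup>*\<^bsub>?H\<^esub> e \<and> e \<rightarrow>\<^sup>*\<^bsub>?H\<^esub> x" if "x \<in> pverts G" for x
  proof (cases "x = e")
    case True
    have "e \<in> verts ?H" using e by (simp add: mk_symmetric_def)
    then show ?thesis using True by simp
  next
    case False
    have "(x, e) \<in> arcs_ends ?H" "(e, x) \<in> arcs_ends ?H"
      using star[OF that False] by (auto simp: mk_symmetric_def intro!: bexI[of _ "(x, e)"])
    then show ?thesis by blast
  qed
  then have "u \<rightarrow>\<^sup>*\<^bsub>?H\<^esub> v" if "u \<in> pverts G" "v \<in> pverts G" for u v
    using that H.reachable_trans by metis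
  moreover have "verts ?H = pverts G"
    by (simp add: mk_symmetric_def)
  ultimately show ?thesis
    unfolding connected_def strongly_connected_def using e by blast
qed

section \<open>Monogenic semigroups\<close>

lemma subsemigroup_generated: "subsemigroup (generated X)"
  unfolding generated_def hull_def subsemigroup_def by blast

lemma generated_closed: "x \<in> generated X \<Longrightarrow> y \<in> generated X \<Longrightarrow> x * y \<in> generated X"
  using subsemigroup_generated unfolding subsemigroup_def by blast

lemma subset_generated: "X \<subseteq> generated X"
  unfolding generated_def by (rule hull_subset)

lemma generated_subset: "X \<subseteq> T \<Longrightarrow> subsemigroup T \<Longrightarrow> generated X \<subseteq> T"
  unfolding generated_def by (rule hull_minimal)

lemma self_in_generated: "a \<in> generated {a}"
  using subset_generated by blast

lemma square_in_generated: "a * a \<in> generated {a}"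
  by (intro generated_closed self_in_generated)

lemma monogenic_insert_power:
  assumes "y \<in> generated {x}"
  shows "monogenic (generated {x, y})"
proof -
  have "generated {x, y} = generated {x}"
    using assms subset_generated[of "{x, y}"] subset_generated[of "{x}"]
    by (intro equalityI generated_subset subsemigroup_generated) auto
  then show ?thesis unfolding monogenic_def by blast
qed

lemma generated_subset_pair:
  assumes "a * a * a = a \<or> a * a * a = a * a"
  shows "generated {a} \<subseteq> {a, a * a}"
proof -
  have "subsemigroup {a, a * a}"
    using assms by (auto simp: subsemigroup_def mult.assoc)
  then show ?thesis by (intro generated_subset) auto
qed

text \<open>
  Both idempotents are powers of the generator, \<open>x = c\<^sup>i\<close> and \<open>y = c\<^sup>j\<close>, and
  \<open>x = x\<^sup>j = c\<^sup>i\<^sup>j = y\<^sup>i = y\<close>.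
\<close>

lemma monogenic_idempotent_unique:
  assumes "x \<in> generated {c}" "y \<in> generated {c}" "x * x = x" "y * y = y"
  shows "x = y"
proof -
  have mult: "sg_power (sg_power c i) k = sg_power c (i * k)" if "i \<ge> 1" "k \<ge> 1" for i k
    using that(2,1)
  proof (induction k rule: nat_induct_at_least)
    case base
    show ?case by (simp only: sg_power_1 mult_1_right)
  next
    case (Suc n)
    then show ?case
      using sg_power_add[of "i * n" i c] by (simp add: sg_power_Suc add.commute)
  qed
  have idem: "sg_power z k = z" if "k \<ge> 1" "z * z = z" for z :: 'a and k
    using that
    by (induction k rule: nat_induct_at_least) (simp_all add: sg_power_1[simplified] sg_power_Suc)
  obtain i j where "i \<ge> 1" "x = sg_power c i" "j \<ge> 1" "y = sg_power c j"
    using assms(1,2) unfolding generated_singleton by blast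
  then show ?thesis
    using mult[of i j] mult[of j i] idem[of j x] idem[of i y] assms(3,4)
    by (simp add: mult.commute)
qed

text \<open>
  Whether the order is 1 or 2 can be read off the first three powers. An element of infinite
  order has \<open>elem_order\<close> 0 and so falls under the contrapositive of \<open>cube_imp_elem_order_le_2\<close>:
  its first three powers are distinct, just as for a finite order above 2.
\<close>

lemma elem_order_le_2_imp_cube:
  assumes "elem_order a \<in> {1, 2}"
  shows "a * a * a = a \<or> a * a * a = a * a"
proof (rule ccontr)
  assume neg: "\<not> ?thesis"
  then have "a \<noteq> a * a" "a \<noteq> a * a * a" "a * a \<noteq> a * a * a"
    by metis+
  then have "card {a, a * a, a * a * a} = 3"
    by simp
  moreover have "{a, a * a, a * a * a} \<subseteq> generated {a}"
    by (auto intro!: generated_closed self_in_generated)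
  moreover have "finite (generated {a})"
    using assms unfolding elem_order_def by (auto intro: card_ge_0_finite)
  ultimately have "3 \<le> elem_order a"
    unfolding elem_order_def by (metis card_mono)
  then show False using assms by auto
qed

lemma cube_imp_elem_order_le_2:
  fixes a :: "'a::semigroup_mult"
  assumes "a * a * a = a \<or> a * a * a = a * a"
  shows "elem_order a \<in> {1, 2}"
proof -
  have "generated {a} = {a, a * a}"
    using generated_subset_pair[OF assms] self_in_generated square_in_generated by blast
  moreover have "card {x, y} \<in> {1, 2}" for x y :: 'a
    by (cases "x = y") auto
  ultimately show ?thesis
    unfolding elem_order_def by metis
qed

lemma cube_imp_square_idempotent:
  fixes a :: "'a::semigroup_mult"
  assumes "a * a * a = a \<or> a * a * a = a * a"
  shows "(a * a) * (a * a) = a * a"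
  using assms by (auto simp: mult.assoc[symmetric])

section \<open>The cyclic graph\<close>

lemma wf_cyclic_graph: "wf_digraph (with_proj (cyclic_graph S))"
  by unfold_locales (auto simp: cyclic_graph_def)

text \<open>
  The triangle is \<open>a, a\<^sup>2, a\<^sup>4\<close> whenever these powers are distinct. Otherwise \<open>a\<^sup>4 = a\<close> or
  \<open>a\<^sup>4 = a\<^sup>2\<close>, and \<open>a, a\<^sup>2, a\<^sup>3\<close> is a triangle: in the first case \<open>a\<^sup>3 = (a\<^sup>2)\<^sup>3\<close>, in the second
  \<open>a\<^sup>2 = (a\<^sup>3)\<^sup>2\<close>. In general \<open>a\<^sup>2\<close> and \<open>a\<^sup>3\<close> need not be adjacent.
\<close>

lemma cyclic_graph_triangle:
  assumes S: "subsemigroup S" and a: "a \<in> S"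
    and cube: "a * a * a \<noteq> a" "a * a * a \<noteq> a * a"
  shows "\<exists>p. pre_digraph.cycle (with_proj (cyclic_graph S)) p \<and> length p \<ge> 3"
proof -
  have powers: "generated {a} \<subseteq> S"
    using S a by (intro generated_subset) auto
  have sq: "a \<noteq> a * a"
    using cube by metis
  have triangle: ?thesis
    if "y \<in> generated {a}" "distinct [a, a * a, y]" "monogenic (generated {a * a, y})" for y
  proof -
    have "pre_digraph.cycle (with_proj (cyclic_graph S)) [(a, a * a), (a * a, y), (y, a)]"
      using that a powers square_in_generated[of a]
        monogenic_insert_power[OF square_in_generated[of a]] monogenic_insert_power[OF that(1)]
      by (intro triangle_cycle) (auto simp: cyclic_graph_def insert_commute[of y a])
    then show ?thesis by (intro exI conjI) auto
  qed
  have cube_in: "a * a * a \<in> generated {a}"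
    by (intro generated_closed self_in_generated)
  consider "a * a * a * a = a" | "a * a * a * a = a * a"
    | "a * a * a * a \<noteq> a" "a * a * a * a \<noteq> a * a" by blast
  then show ?thesis
  proof cases
    case 1
    have "a * a * a = (a * a) * (a * a) * (a * a)"
      using 1 by (simp add: mult.assoc[symmetric])
    then have "a * a * a \<in> generated {a * a}"
      by (metis generated_closed self_in_generated)
    then show ?thesis
      using cube sq by (intro triangle[OF cube_in] monogenic_insert_power) auto
  next
    case 2
    have "a * a = (a * a * a) * (a * a * a)"
      using 2 by (simp add: mult.assoc[symmetric])
    then have "a * a \<in> generated {a * a * a}"
      by (metis square_in_generated)
    then have "monogenic (generated {a * a, a * a * a})"
      using monogenic_insert_power by (metis insert_commute)
    then show ?thesis
      using cube sq by (intro triangle[OF cube_in]) auto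
  next
    case 3
    have eq: "a * a * a * a = (a * a) * (a * a)"
      by (simp add: mult.assoc)
    have "a * a * a * a \<in> generated {a * a}"
      unfolding eq by (rule square_in_generated)
    moreover have "a * a * a * a \<in> generated {a}"
      by (intro generated_closed self_in_generated)
    ultimately show ?thesis
      using 3 sq triangle monogenic_insert_power by (metis distinct_length_2_or_more distinct_singleton)
  qed
qed

lemma adjacent_imp_square_eq:
  assumes "(x, y) \<in> parcs (cyclic_graph S)"
    and "(x * x) * (x * x) = x * x" "(y * y) * (y * y) = y * y"
  shows "x * x = y * y"
proof -
  obtain c where "generated {x, y} = generated {c}"
    using assms(1) by (auto simp: cyclic_graph_def monogenic_def)
  then have "x \<in> generated {c}" "y \<in> generated {c}"
    using subset_generated[of "{x, y}"] by auto
  then have "x * x \<in> generated {c}" "y * y \<in> generated {c}"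
    by (simp_all add: generated_closed)
  then show ?thesis
    using assms(2,3) by (rule monogenic_idempotent_unique)
qed

text \<open>
  A common generator \<open>c\<close> of two adjacent elements lies in \<open>S\<close> as well, so \<open>c\<^sup>2 = e\<close> and both
  elements lie in \<open>{c, e}\<close>.
\<close>

lemma adjacent_imp_idempotent:
  assumes S: "subsemigroup S" and edge: "(x, y) \<in> parcs (cyclic_graph S)"
    and sq: "\<And>z. z \<in> S \<Longrightarrow> z * z = e"
    and cube: "\<And>z. z \<in> S \<Longrightarrow> z * z * z = z \<or> z * z * z = z * z"
  shows "x = e \<or> y = e"
proof -
  obtain c where c: "generated {x, y} = generated {c}"
    and xy: "x \<in> S" "y \<in> S" "x \<noteq> y"
    using edge by (auto simp: cyclic_graph_def monogenic_def)
  have "c \<in> generated {x, y}"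
    using c self_in_generated by simp
  then have "c \<in> S"
    using S xy generated_subset[of "{x, y}" S] by auto
  then have "generated {c} \<subseteq> {c, e}"
    using generated_subset_pair[OF cube] sq by auto
  then show ?thesis
    using c xy subset_generated[of "{x, y}"] by auto
qed

theorem corollary3p9:
  fixes S :: "'a::semigroup_mult set"
  assumes "subsemigroup S"
    and "bounded_exponent S"
  shows "undirected_tree (cyclic_graph S) \<longleftrightarrow>
    card (idempotents S) = 1 \<and> order_set S \<subseteq> {1, 2}"
proof
  assume tree: "undirected_tree (cyclic_graph S)"
  have cube: "x * x * x = x \<or> x * x * x = x * x" if "x \<in> S" for x
    using cyclic_graph_triangle[OF assms(1) that] tree
    unfolding undirected_tree_def by blast
  then have orders: "order_set S \<subseteq> {1, 2}"
    unfolding order_set_def using cube_imp_elem_order_le_2 by blast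
  have square: "x * x \<in> idempotents S" if "x \<in> S" for x
    using cube_imp_square_idempotent[OF cube[OF that]] assms(1) that
    by (auto simp: idempotents_def subsemigroup_def)
  have conn: "connected (with_proj (cyclic_graph S))"
    using tree by (simp add: undirected_tree_def)
  have square_eq: "x * x = y * y" if "x \<in> S" "y \<in> S" for x y
  proof (rule adjacent_imp_eq_imp_connected_imp_eq
        [where f = "\<lambda>x. x * x", OF conn])
    fix a assume a: "a \<in> arcs (with_proj (cyclic_graph S))"
    then have "fst a \<in> S" "snd a \<in> S"
      by (auto simp: cyclic_graph_def)
    then show "tail (cyclic_graph S) a * tail (cyclic_graph S) a =
        head (cyclic_graph S) a * head (cyclic_graph S) a"
      using a adjacent_imp_square_eq[of "fst a" "snd a" S] square
      by (simp add: idempotents_def)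
  qed (use that in \<open>auto simp: cyclic_graph_def\<close>)
  obtain x where x: "x \<in> S"
    using conn by (auto simp: connected_def strongly_connected_def mk_symmetric_def
        cyclic_graph_def)
  have "idempotents S = {x * x}"
  proof
    show "idempotents S \<subseteq> {x * x}"
      using square_eq[OF _ x] by (force simp: idempotents_def)
  qed (use square[OF x] in simp)
  with orders show "card (idempotents S) = 1 \<and> order_set S \<subseteq> {1, 2}"
    by simp
next
  assume R: "card (idempotents S) = 1 \<and> order_set S \<subseteq> {1, 2}"
  then obtain e where e: "idempotents S = {e}"
    by (auto simp: card_1_singleton_iff)
  then have eS: "e \<in> S"
    by (auto simp: idempotents_def)
  have cube: "x * x * x = x \<or> x * x * x = x * x" if "x \<in> S" for x
    using R that by (intro elem_order_le_2_imp_cube) (auto simp: order_set_def)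
  have sq: "x * x = e" if "x \<in> S" for x
  proof -
    have "x * x \<in> idempotents S"
      using cube_imp_square_idempotent[OF cube[OF that]] assms(1) that
      by (auto simp: idempotents_def subsemigroup_def)
    then show ?thesis using e by simp
  qed
  have "(x, e) \<in> parcs (cyclic_graph S)" if "x \<in> S" "x \<noteq> e" for x
    using that eS monogenic_insert_power[OF square_in_generated[of x]] sq[OF that(1)]
    by (auto simp: cyclic_graph_def)
  then have "connected (with_proj (cyclic_graph S))"
    using eS by (intro star_connected[OF wf_cyclic_graph, of e]) (auto simp: cyclic_graph_def)
  moreover have "length p < 3" if "pre_digraph.cycle (with_proj (cyclic_graph S)) p" for p
    using adjacent_imp_idempotent[OF assms(1) _ sq cube] that by (rule star_no_cycle)
  ultimately show "undirected_tree (cyclic_graph S)"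
    unfolding undirected_tree_def by (meson not_le)
qed

end
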